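(* Let $G$ be a graph and let $A\subseteq V(G)$ be an independent set of $G$ such that $G$ has a matching $M$ of size $|V(G)|-|A|$ that saturates all vertices in $V(G)\setminus A$, and $d(v)\ge 3$ for every $v\in A$. Then $G$ admits an antimagic orientation.
   Context: All graphs are finite and simple; graphs are not assumed connected unless stated. $d(v)$ denotes the degree of $v$ in $G$. A matching saturates a vertex if some edge of the matching is incident with it. For a digraph $D$ with $m$ arcs, arc set $A(D)$, and a bijection $\tau:A(D)\to\{1,2,\ldots,m\}$, the vertex-sum $s_{(D,\tau)}(u)$ of a vertex $u$ is the sum of the labels of all arcs entering $u$ minus the sum of the labels of all arcs leaving $u$ (and $s_{(D,\tau)}(u):=0$ if $u$ is isolated). The bijection $\tau$ is an antimagic labeling of $D$ if $s_{(D,\tau)}(u)\ne s_{(D,\tau)}(v)$ for all distinct vertices $u,v$ of $D$. An antimagic orientation of a graph $G$ is a pair $(D,\tau)$ where $D$ is an orientation of $G$ (each edge of $G$ is replaced by exactly one of its two possible arcs) and $\tau$ is an antimagic labeling of $D$. *)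

theory Defs
  imports "Graph_Theory.Graph_Theory"
begin

text \<open>
  As in Graph\_Theory, a finite simple graph is a symmetric loop-free digraph
  (\<^locale>\<open>pair_graph\<close>). Its undirected edges are the two-element sets obtained by forgetting
  the directions, so that each pair of opposite arcs is counted once.
\<close>

definition edges_of :: "'a pair_pre_digraph \<Rightarrow> 'a set set" where
  "edges_of G = (\<lambda>(u, v). {u, v}) ` parcs G"

definition vertex_degree :: "'a pair_pre_digraph \<Rightarrow> 'a \<Rightarrow> nat" where
  "vertex_degree G v = card {e \<in> edges_of G. v \<in> e}"

definition independent_set :: "'a pair_pre_digraph \<Rightarrow> 'a set \<Rightarrow> bool" where
  "independent_set G A \<longleftrightarrow>
     A \<subseteq> pverts G \<and> (\<forall>u\<in>A. \<forall>v\<in>A. {u, v} \<notin> edges_of G)"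

definition matching :: "'a pair_pre_digraph \<Rightarrow> 'a set set \<Rightarrow> bool" where
  "matching G M \<longleftrightarrow>
     M \<subseteq> edges_of G \<and> (\<forall>e\<in>M. \<forall>f\<in>M. e \<noteq> f \<longrightarrow> e \<inter> f = {})"

definition saturates :: "'a set set \<Rightarrow> 'a \<Rightarrow> bool" where
  "saturates M v \<longleftrightarrow> (\<exists>e\<in>M. v \<in> e)"

definition orientation_of :: "'a pair_pre_digraph \<Rightarrow> 'a pair_pre_digraph \<Rightarrow> bool" where
  "orientation_of D G \<longleftrightarrow>
     pverts D = pverts G \<and> parcs D \<subseteq> parcs G \<and>
     (\<forall>(u, v)\<in>parcs G. (u, v) \<in> parcs D \<longleftrightarrow> (v, u) \<notin> parcs D)"

text \<open>For an isolated vertex both sums are empty, so the vertex-sum is 0.\<close>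

definition vertex_sum :: "'a pair_pre_digraph \<Rightarrow> ('a \<times> 'a \<Rightarrow> nat) \<Rightarrow> 'a \<Rightarrow> int" where
  "vertex_sum D \<tau> u =
     (\<Sum>a\<in>in_arcs (with_proj D) u. int (\<tau> a)) - (\<Sum>a\<in>out_arcs (with_proj D) u. int (\<tau> a))"

definition antimagic_labeling :: "'a pair_pre_digraph \<Rightarrow> ('a \<times> 'a \<Rightarrow> nat) \<Rightarrow> bool" where
  "antimagic_labeling D \<tau> \<longleftrightarrow>
     bij_betw \<tau> (parcs D) {1..card (parcs D)} \<and>
     (\<forall>u\<in>pverts D. \<forall>v\<in>pverts D. u \<noteq> v \<longrightarrow> vertex_sum D \<tau> u \<noteq> vertex_sum D \<tau> v)"

definition antimagic_orientation ::
    "'a pair_pre_digraph \<Rightarrow> 'a pair_pre_digraph \<times> ('a \<times> 'a \<Rightarrow> nat) \<Rightarrow> bool" where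
  "antimagic_orientation G = (\<lambda>(D, \<tau>). orientation_of D G \<and> antimagic_labeling D \<tau>)"

end

theory Submission
  imports Defs "HOL-Library.Multiset" "HOL-Library.Disjoint_Sets"
begin

text \<open>
  Let \<open>B\<close> be the complement of \<open>A\<close>. As \<open>A\<close> is independent, the size of the matching forces each
  of its edges to join \<open>B\<close> to \<open>A\<close>, so it is an injection from \<open>B\<close> into \<open>A\<close>
  (\<open>saturating_matching_injection\<close>). Each \<open>a \<in> A\<close> selects one primary edge: its matching edge, or
  an arbitrary edge if it is unmatched. Its other edges are secondary; there are at least two of
  them. All edges between \<open>A\<close> and \<open>B\<close> are oriented towards \<open>B\<close>, so that vertices of \<open>A\<close> have
  negative sums. The secondary edges get the smallest labels, the edges inside \<open>B\<close> the next ones,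
  and the primary edges the largest.

  \<^bold>\<open>Vertices of B against vertices of A.\<close> Decompose the edges inside \<open>B\<close> into a minimum
  number of trails, orient along the trails, and use the labels in decreasing order. Passing
  through a vertex contributes \<open>+1\<close>, and no vertex is the start of two trails, so inside \<open>B\<close> no
  vertex loses more than the largest label used there (\<open>orientation_with_small_deficits\<close>). The
  label of its matching edge is larger still, and all sums in \<open>B\<close> are positive.

  \<^bold>\<open>Vertices within B.\<close> Once all labels except those of the matching are fixed, larger matching
  labels are given to vertices of \<open>B\<close> with larger partial sums (\<open>labels_following_weights\<close>).

  \<^bold>\<open>Vertices within A.\<close> The last step permutes the primary labels in an uncontrolled manner, so
  the sums in \<open>A\<close> must be distinct for every assignment of the \<open>q = |A|\<close> primary labels. These lie
  in an interval of length \<open>q\<close>. Hence it suffices that the sums of secondary labels at any two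
  vertices of \<open>A\<close> are equal or differ by at least \<open>q\<close>. This is achieved by making all of them
  multiples of \<open>N / 2\<close> for some \<open>N \<ge> 2 q\<close>: the secondary labels are \<open>1, \<dots>, S\<close> with
  \<open>S \<ge> 2 q\<close>, because every degree in \<open>A\<close> is at least 3, and this interval splits into blocks of
  prescribed sizes at least 2 with such sums (\<open>zero_sum_blocks\<close>).
\<close>

section \<open>Partitions of an interval with block sums divisible by N/2\<close>

text \<open>
  Measured from the midpoint of the interval, the triples have offset sum 0. With
  \<open>2 r + 1\<close> triples the offsets are \<open>-(3 r + 1), \<dots>, 3 r + 1\<close>; each triple takes one offset
  from the lower, the middle and the upper third. As the upper offset runs through its third in
  steps of 2, the middle and the lower offset each go down by 1, which keeps the sum constant. One
  pass (\<open>A\<close>, of \<open>r + 1\<close> triples) uses the upper offsets of one parity, a second pass (\<open>B\<close>, of \<open>r\<close>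
  triples) those of the other. For an even number of triples the common sum would not be an
  integer.
\<close>

lemma zero_sum_triples:
  assumes "finite T" "odd (card T)"
  shows "\<exists>Y. disjoint_family_on Y T \<and>
    (\<forall>a\<in>T. Y a \<subseteq> {p + 1..p + 3 * card T} \<and> card (Y a) = 3 \<and>
      2 * \<Sum>(Y a) = 3 * (2 * p + 3 * card T + 1))"
proof -
  from assms(2) obtain r where r: "card T = 2 * r + 1" by (elim oddE)
  define A where "A w = {p + r + 1 - w, p + 4 * r + 2 - w, p + 4 * r + 3 + 2 * w}" for w
  define B where "B w = {p + 2 * r + 1 - w, p + 3 * r + 1 - w, p + 4 * r + 4 + 2 * w}" for w
  define Z where "Z i = (if i \<le> r then A i else B (i - Suc r))" for i
  have AA: "A w \<inter> A w' = {}" if "w \<le> r" "w' \<le> r" "w \<noteq> w'" for w w'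
    using that unfolding A_def by auto
  have BB: "B w \<inter> B w' = {}" if "w < r" "w' < r" "w \<noteq> w'" for w w'
    using that unfolding B_def by auto
  have AB: "A w \<inter> B w' = {}" if "w \<le> r" "w' < r" for w w'
  proof -
    have "p + 4 * r + 3 + 2 * w \<noteq> p + 4 * r + 4 + 2 * w'" by presburger
    then show ?thesis using that unfolding A_def B_def by auto
  qed
  have Z_disj: "Z i \<inter> Z j = {}" if ij: "i < 2 * r + 1" "j < 2 * r + 1" "i \<noteq> j" for i j
  proof -
    have lt: "k - Suc r < r" if "k < 2 * r + 1" "\<not> k \<le> r" for k
      using that by linarith
    show ?thesis
    proof (cases "i \<le> r"; cases "j \<le> r")
      assume "i \<le> r" "j \<le> r"
      then show ?thesis using AA ij unfolding Z_def by simp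
    next
      assume "i \<le> r" "\<not> j \<le> r"
      then show ?thesis using AB lt ij unfolding Z_def by simp
    next
      assume "\<not> i \<le> r" "j \<le> r"
      then show ?thesis using AB lt ij unfolding Z_def by (simp add: Int_commute)
    next
      assume h: "\<not> i \<le> r" "\<not> j \<le> r"
      then have "i - Suc r \<noteq> j - Suc r" using ij(3) by linarith
      then show ?thesis using BB lt ij h unfolding Z_def by simp
    qed
  qed
  have Z_ok: "Z i \<subseteq> {p + 1..p + 3 * card T} \<and> card (Z i) = 3 \<and>
      2 * \<Sum>(Z i) = 3 * (2 * p + 3 * card T + 1)" if i: "i < 2 * r + 1" for i
  proof (cases "i \<le> r")
    case True
    then have "p + r + 1 - i \<noteq> p + 4 * r + 2 - i"
      by linarith
    with True show ?thesis unfolding Z_def A_def r by auto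
  next
    case False
    then obtain w where "i = Suc r + w" using less_iff_Suc_add[of r i] by auto
    then have w: "i = Suc r + w" "w < r" using i by simp_all
    have "p + 2 * r + 1 - w \<noteq> p + 3 * r + 1 - w" using w by linarith
    with w show ?thesis unfolding Z_def B_def r by auto
  qed
  obtain h where h: "bij_betw h T {0..<card T}"
    using ex_bij_betw_finite_nat assms(1) by blast
  then have h_lt: "h a < 2 * r + 1" if "a \<in> T" for a
    using that r bij_betwE by fastforce
  have h_inj: "h a \<noteq> h b" if "a \<in> T" "b \<in> T" "a \<noteq> b" for a b
    using that h by (auto simp: bij_betw_def inj_on_def)
  have "disjoint_family_on (Z \<circ> h) T"
    unfolding disjoint_family_on_def using Z_disj h_lt h_inj by simp
  then show ?thesis using Z_ok h_lt by (intro exI[of _ "Z \<circ> h"]) simp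
qed

lemma interval_partition:
  fixes p :: "'a \<Rightarrow> nat"
  assumes "finite A"
  shows "\<exists>Q. disjoint_family_on Q A \<and> (\<forall>a\<in>A. Q a \<subseteq> {1..sum p A} \<and> card (Q a) = p a)"
  using assms
proof induction
  case empty
  then show ?case by (simp add: disjoint_family_on_def)
next
  case (insert x A)
  then obtain Q where Q: "disjoint_family_on Q A"
    "\<And>a. a \<in> A \<Longrightarrow> Q a \<subseteq> {1..sum p A}" "\<And>a. a \<in> A \<Longrightarrow> card (Q a) = p a" by blast
  let ?Q = "Q(x := {sum p A + 1..sum p A + p x})"
  have "Q a \<inter> {sum p A + 1..sum p A + p x} = {}" if "a \<in> A" for a
    using Q(2)[OF that] by auto
  then have "disjoint_family_on ?Q (insert x A)"
    using Q(1) insert.hyps(2) unfolding disjoint_family_on_def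
    by (auto simp: Int_commute)
  moreover have "?Q a \<subseteq> {1..sum p (insert x A)} \<and> card (?Q a) = p a" if "a \<in> insert x A" for a
  proof (cases "a = x")
    case True
    then show ?thesis using insert.hyps by auto
  next
    case False
    then have "a \<in> A" using that by simp
    then show ?thesis using False Q(2,3)[of a] insert.hyps by fastforce
  qed
  ultimately show ?case by blast
qed

text \<open>
  Pairs \<open>{i, N - i}\<close> have sum \<open>N\<close>, and triples centred at \<open>N / 2\<close> have sum \<open>3 N / 2\<close>. Hence a block
  made of pairs and at most one such triple has a sum that is a multiple of \<open>N / 2\<close>. The triples
  occupy the middle of \<open>{1..<N}\<close>, and what remains is a union of pairs.
\<close>

lemma zero_sum_blocks_few_odd:
  fixes p :: "'a \<Rightarrow> nat"
  assumes fin: "finite A" and T: "T \<subseteq> A" "T = {} \<or> odd (card T)"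
  defines "N \<equiv> 2 * sum p A + 3 * card T + 1"
  shows "\<exists>X. disjoint_family_on X A \<and>
    (\<forall>a\<in>A. X a \<subseteq> {1..<N} \<and> card (X a) = 2 * p a + (if a \<in> T then 3 else 0) \<and>
      N dvd 2 * \<Sum>(X a))"
proof -
  let ?P = "sum p A"
  have "finite T" using fin T(1) finite_subset by blast
  have "\<exists>Y. disjoint_family_on Y T \<and> (\<forall>a\<in>T. Y a \<subseteq> {?P + 1..?P + 3 * card T} \<and>
      card (Y a) = 3 \<and> 2 * \<Sum>(Y a) = 3 * N)"
  proof (cases "T = {}")
    case False
    then show ?thesis
      using zero_sum_triples[OF \<open>finite T\<close>, of ?P] T(2) unfolding N_def by blast
  qed (simp add: disjoint_family_on_def)
  then obtain Y where Y: "disjoint_family_on Y T"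
    "\<And>a. a \<in> T \<Longrightarrow> Y a \<subseteq> {?P + 1..?P + 3 * card T}" "\<And>a. a \<in> T \<Longrightarrow> card (Y a) = 3"
    "\<And>a. a \<in> T \<Longrightarrow> 2 * \<Sum>(Y a) = 3 * N" by blast
  obtain Q where Q: "disjoint_family_on Q A" "\<And>a. a \<in> A \<Longrightarrow> Q a \<subseteq> {1..?P}"
    "\<And>a. a \<in> A \<Longrightarrow> card (Q a) = p a"
    using interval_partition[OF fin, of p] by blast
  \<comment> \<open>\<open>Q\<close>, \<open>Y'\<close> and \<open>R\<close> live in the lower, middle and upper part of \<open>{1..<N}\<close>.\<close>
  define Y' where "Y' a = (if a \<in> T then Y a else {})" for a
  define R where "R a = (\<lambda>i. N - i) ` Q a" for a
  have Y'_sub: "Y' a \<subseteq> {?P + 1..?P + 3 * card T}" for a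
    using Y(2) unfolding Y'_def by auto
  have R_sub: "R a \<subseteq> {?P + 3 * card T + 1..<N}" if "a \<in> A" for a
    using Q(2)[OF that] unfolding R_def N_def by fastforce
  have inj: "inj_on (\<lambda>i. N - i) {1..?P}"
    unfolding N_def by (auto simp: inj_on_def)
  have fin': "finite (Y' a)" "finite (R a)" "finite (Q a)" if "a \<in> A" for a
    using Y'_sub[of a] R_sub[OF that] Q(2)[OF that] finite_subset by blast+
  define X where "X a = Q a \<union> Y' a \<union> R a" for a
  have low: "x \<le> ?P" if "a \<in> A" "x \<in> Q a" for a x using Q(2)[OF that(1)] that(2) by auto
  have mid: "?P < x \<and> x \<le> ?P + 3 * card T" if "x \<in> Y' a" for a x using Y'_sub[of a] that by auto
  have high: "?P + 3 * card T < x" if "a \<in> A" "x \<in> R a" for a x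
    using R_sub[OF that(1)] that(2) by auto
  have sep: "Q a \<inter> Y' b = {}" "Q a \<inter> R b = {}" "Y' a \<inter> R b = {}" if "a \<in> A" "b \<in> A" for a b
    using low[OF that(1)] mid high[OF that(2)] by fastforce+
  have R_disj: "R a \<inter> R b = {}" if "a \<in> A" "b \<in> A" "a \<noteq> b" for a b
  proof -
    have "R a \<inter> R b = (\<lambda>i. N - i) ` (Q a \<inter> Q b)"
      unfolding R_def using inj_on_image_Int[OF inj] Q(2) that by metis
    then show ?thesis using Q(1) that by (auto simp: disjoint_family_on_def)
  qed
  have Y'_disj: "Y' a \<inter> Y' b = {}" if "a \<noteq> b" for a b
    using Y(1) that unfolding Y'_def by (auto simp: disjoint_family_on_def)
  have "disjoint_family_on X A"
    unfolding disjoint_family_on_def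
  proof (intro ballI impI)
    fix a b assume ab: "a \<in> A" "b \<in> A" "a \<noteq> b"
    then have "Q a \<inter> Q b = {}" using Q(1) by (simp add: disjoint_family_on_def)
    then show "X a \<inter> X b = {}"
      unfolding X_def using sep[OF ab(1,2)] sep[OF ab(2,1)] R_disj[OF ab] Y'_disj[OF ab(3)] by blast
  qed
  moreover have "X a \<subseteq> {1..<N} \<and> card (X a) = 2 * p a + (if a \<in> T then 3 else 0) \<and>
      N dvd 2 * \<Sum>(X a)" if a: "a \<in> A" for a
  proof (intro conjI)
    have "{1..?P} \<subseteq> {1..<N}" "{?P + 1..?P + 3 * card T} \<subseteq> {1..<N}"
      "{?P + 3 * card T + 1..<N} \<subseteq> {1..<N}" unfolding N_def by auto
    then show "X a \<subseteq> {1..<N}" unfolding X_def using Q(2)[OF a] Y'_sub[of a] R_sub[OF a] by blast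
    have injQ: "inj_on (\<lambda>i. N - i) (Q a)" using inj_on_subset[OF inj Q(2)[OF a]] .
    have disj: "Q a \<inter> Y' a = {}" "(Q a \<union> Y' a) \<inter> R a = {}"
      using sep[OF a a] by blast+
    have "card (R a) = p a" unfolding R_def using card_image[OF injQ] Q(3)[OF a] by simp
    moreover have "card (Y' a) = (if a \<in> T then 3 else 0)" using Y(3) unfolding Y'_def by simp
    ultimately show "card (X a) = 2 * p a + (if a \<in> T then 3 else 0)"
      unfolding X_def using Q(3)[OF a] fin'[OF a] disj by (simp add: card_Un_disjoint)
    have "\<Sum>(Q a) + \<Sum>(R a) = (\<Sum>i\<in>Q a. i + (N - i))"
      unfolding R_def sum.distrib using sum.reindex[OF injQ, of "\<lambda>x. x"] by simp
    also have "\<dots> = (\<Sum>i\<in>Q a. N)"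
      using low[OF a] unfolding N_def by (intro sum.cong) fastforce+
    finally have QR: "\<Sum>(Q a) + \<Sum>(R a) = card (Q a) * N" by simp
    have "\<Sum>(X a) = \<Sum>(Q a) + \<Sum>(Y' a) + \<Sum>(R a)"
      unfolding X_def using fin'[OF a] disj by (simp add: sum.union_disjoint)
    then have "2 * \<Sum>(X a) = 2 * (card (Q a) * N) + 2 * \<Sum>(Y' a)" using QR by simp
    moreover have "N dvd 2 * \<Sum>(Y' a)" using Y(4) unfolding Y'_def by simp
    ultimately show "N dvd 2 * \<Sum>(X a)" by simp
  qed
  ultimately show ?thesis by blast
qed

text \<open>
  Every odd block gets one triple. If their number \<open>t\<close> is odd or 0, the previous lemma applies with
  \<open>N = sum d A + 1\<close>. If \<open>t\<close> is even and positive, one odd block \<open>z\<close> gets, instead of a triple, the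
  largest label \<open>sum d A\<close>; this label is \<open>N\<close> itself for the remaining symmetric interval, and so it
  does not affect divisibility. The factor 2 is there for the triples, whose sum is \<open>3 N / 2\<close>.
\<close>

lemma zero_sum_blocks:
  fixes d :: "'a \<Rightarrow> nat"
  assumes fin: "finite A" and d: "\<And>a. a \<in> A \<Longrightarrow> 2 \<le> d a"
  shows "\<exists>X N. 2 * card A \<le> N \<and> disjoint_family_on X A \<and>
    (\<forall>a\<in>A. X a \<subseteq> {1..sum d A} \<and> card (X a) = d a \<and> N dvd 2 * \<Sum>(X a))"
proof -
  define U where "U = {a \<in> A. odd (d a)}"
  have finU: "finite U" and UA: "U \<subseteq> A" using fin unfolding U_def by auto
  have large: "2 * card A \<le> sum d A"
    using sum_mono[of A "\<lambda>_. 2" d] d by simp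
  have odd3: "3 \<le> d a" if "a \<in> U" for a
  proof -
    have "2 \<le> d a" "odd (d a)" using that d unfolding U_def by auto
    then show ?thesis by (cases "d a = 2") auto
  qed
  show ?thesis
  proof (cases "U = {} \<or> odd (card U)")
    case True
    define p where "p a = (if a \<in> U then (d a - 3) div 2 else d a div 2)" for a
    have dp: "d a = 2 * p a + (if a \<in> U then 3 else 0)" if "a \<in> A" for a
    proof (cases "a \<in> U")
      case True
      then have "even (d a - 3)" using odd3[OF True] unfolding U_def by simp
      then show ?thesis using True odd3[OF True] unfolding p_def by simp
    next
      case False
      then show ?thesis using that unfolding p_def U_def by simp
    qed
    have "sum d A = (\<Sum>a\<in>A. 2 * p a + (if a \<in> U then 3 else 0))"
      using dp by (rule sum.cong[OF refl])
    also have "\<dots> = 2 * sum p A + 3 * card U"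
      using fin UA by (simp add: sum.distrib sum_distrib_left sum.inter_restrict[symmetric] Int_absorb1)
    finally have S: "sum d A = 2 * sum p A + 3 * card U" .
    obtain X where "disjoint_family_on X A" "\<forall>a\<in>A. X a \<subseteq> {1..<sum d A + 1} \<and>
        card (X a) = 2 * p a + (if a \<in> U then 3 else 0) \<and> (sum d A + 1) dvd 2 * \<Sum>(X a)"
      using zero_sum_blocks_few_odd[OF fin UA True, of p] unfolding S by blast
    then show ?thesis
      using dp large by (intro exI[of _ X] exI[of _ "sum d A + 1"]) (simp add: atLeastLessThanSuc_atLeastAtMost)
  next
    case False
    then obtain z where z: "z \<in> U" by blast
    then have zA: "z \<in> A" using UA by blast
    define T where "T = U - {z}"
    have TA: "T \<subseteq> A" and "odd (card T)" and zT: "z \<notin> T"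
      using UA False z finU unfolding T_def by auto
    define p where "p a = (if a \<in> T then (d a - 3) div 2 else d a div 2)" for a
    have dp: "d a = 2 * p a + (if a \<in> T then 3 else 0) + (if a = z then 1 else 0)" if "a \<in> A" for a
    proof (cases "a \<in> U")
      case True
      then have "even (d a - 3)" "odd (d a)" using odd3[OF True] unfolding U_def by simp_all
      then show ?thesis using True odd3[OF True] unfolding p_def T_def by auto
    next
      case False
      then show ?thesis using that z unfolding p_def U_def T_def by auto
    qed
    have "sum d A = (\<Sum>a\<in>A. 2 * p a + (if a \<in> T then 3 else 0) + (if a = z then 1 else 0))"
      using dp by (rule sum.cong[OF refl])
    also have "\<dots> = 2 * sum p A + 3 * card T + 1"
      using fin TA zA
      by (simp add: sum.distrib sum_distrib_left sum.inter_restrict[symmetric] Int_absorb1)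
    finally have S: "sum d A = 2 * sum p A + 3 * card T + 1" .
    obtain X where X: "disjoint_family_on X A" "\<forall>a\<in>A. X a \<subseteq> {1..<sum d A} \<and>
        card (X a) = 2 * p a + (if a \<in> T then 3 else 0) \<and> sum d A dvd 2 * \<Sum>(X a)"
      using zero_sum_blocks_few_odd[OF fin TA, of p] \<open>odd (card T)\<close> unfolding S by blast
    let ?X = "X(z := insert (sum d A) (X z))"
    have notin: "sum d A \<notin> X a" if "a \<in> A" for a using X(2) that by fastforce
    have finX: "finite (X z)" using X(2) zA finite_subset by blast
    have "disjoint_family_on ?X A"
      using X(1) notin zA unfolding disjoint_family_on_def by (auto simp: Int_commute)
    moreover have "?X a \<subseteq> {1..sum d A} \<and> card (?X a) = d a \<and> sum d A dvd 2 * \<Sum>(?X a)"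
      if a: "a \<in> A" for a
    proof -
      have "X a \<subseteq> {1..sum d A}" using X(2) a by fastforce
      moreover have "1 \<le> sum d A" unfolding S by simp
      ultimately show ?thesis using X(2) a dp[OF a] zT notin[OF zA] finX
        by (cases "a = z") (simp_all add: distrib_left)
    qed
    ultimately show ?thesis using large by blast
  qed
qed

text \<open>
  Two block sums that differ by less than \<open>q\<close> are equal, as twice their difference is a multiple
  of \<open>N \<ge> 2 q\<close>. So adding distinct labels from an interval of length \<open>q\<close> to block sums, in any
  manner, yields distinct totals.
\<close>

lemma eq_of_small_shift:
  fixes x y :: nat
  assumes dvd: "N dvd 2 * x" "N dvd 2 * y" and N: "2 * q \<le> N"
    and l: "k \<in> {c + 1..c + q}" "l \<in> {c + 1..c + q}" and eq: "x + k = y + l"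
  shows "k = l"
proof -
  have "int N dvd int (2 * x) - int (2 * y)"
    using dvd by (intro dvd_diff) (simp_all only: int_dvd_int_iff)
  moreover have "int (2 * x) - int (2 * y) = 2 * (int l - int k)"
    using arg_cong[OF eq, of int] by simp
  ultimately have "int N dvd 2 * (int l - int k)" by simp
  moreover have "\<bar>2 * (int l - int k)\<bar> < int N" using l N by auto
  ultimately have "2 * (int l - int k) = 0"
    using dvd_imp_le_int[of "2 * (int l - int k)" "int N"] by linarith
  then show ?thesis by simp
qed

section \<open>Orienting and labelling along trails\<close>

fun trail_arcs :: "'a list \<Rightarrow> ('a \<times> 'a) list" where
  "trail_arcs (x # y # w) = (x, y) # trail_arcs (y # w)"
| "trail_arcs w = []"

definition trail_edges :: "'a list \<Rightarrow> 'a set list" where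
  "trail_edges w = map (\<lambda>(x, y). {x, y}) (trail_arcs w)"

lemma trail_edges_simps [simp]:
  "trail_edges [] = []" "trail_edges [x] = []"
  "trail_edges (x # y # w) = {x, y} # trail_edges (y # w)"
  by (simp_all add: trail_edges_def)

lemma trail_edges_append:
  "trail_edges (xs @ x # ys) = trail_edges (xs @ [x]) @ trail_edges (x # ys)"
proof (induction xs)
  case (Cons y xs)
  then show ?case by (cases xs) simp_all
qed simp

lemma trail_edges_rev: "trail_edges (rev w) = rev (trail_edges w)"
proof (induction w rule: trail_arcs.induct)
  case (1 x y w)
  have "trail_edges (rev (x # y # w)) = trail_edges (rev w @ y # [x])" by simp
  also have "\<dots> = trail_edges (rev w @ [y]) @ [{y, x}]"
    by (simp only: trail_edges_append[of "rev w" y "[x]"] trail_edges_simps)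
  also have "trail_edges (rev w @ [y]) = rev (trail_edges (y # w))" using 1 by simp
  finally show ?case by (simp add: insert_commute)
qed simp_all

text \<open>
  A trail is given by its vertex sequence. It may be closed, and may visit vertices repeatedly;
  only edges are not repeated, which the multiset equation expresses.
\<close>

definition trail_decomposition :: "'a set set \<Rightarrow> 'a list list \<Rightarrow> bool" where
  "trail_decomposition E ws \<longleftrightarrow>
     [] \<notin> set ws \<and> mset (concat (map trail_edges ws)) = mset_set E"

lemma trail_decomposition_exists:
  assumes "finite E" "\<And>e. e \<in> E \<Longrightarrow> \<exists>x y. e = {x, y}"
  shows "\<exists>ws. trail_decomposition E ws"
  using assms
proof (induction E)
  case empty
  then show ?case by (intro exI[of _ "[]"]) (simp add: trail_decomposition_def)
next
  case (insert e E)
  then obtain ws where "trail_decomposition E ws" by blast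
  moreover obtain x y where "e = {x, y}" using insert.prems by blast
  ultimately have "trail_decomposition (insert e E) ([x, y] # ws)"
    using insert.hyps by (simp add: trail_decomposition_def)
  then show ?case ..
qed

text \<open>
  In a decomposition into as few trails as possible the first vertices are distinct: if two trails
  started at the same vertex, then the reverse of one followed by the other would be a single
  trail.
\<close>

lemma trail_decomposition_distinct_heads:
  assumes "finite E" "\<And>e. e \<in> E \<Longrightarrow> \<exists>x y. e = {x, y}"
  shows "\<exists>ws. trail_decomposition E ws \<and> distinct (map hd ws)"
proof -
  obtain ws where ws: "trail_decomposition E ws"
    and least: "\<And>ws'. trail_decomposition E ws' \<Longrightarrow> length ws \<le> length ws'"
    using trail_decomposition_exists[OF assms] ex_has_least_nat[of "trail_decomposition E" _ length]
    by metis
  have "distinct (map hd ws)"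
  proof (rule ccontr)
    assume "\<not> distinct (map hd ws)"
    then obtain as x bs cs where "map hd ws = as @ [x] @ bs @ [x] @ cs"
      using not_distinct_decomp by blast
    then have "map hd ws = as @ x # (bs @ x # cs)" by (simp only: append_Cons append_Nil)
    from map_eq_append_conv[THEN iffD1, OF this]
    obtain As ws1 where 1: "ws = As @ ws1" "x # (bs @ x # cs) = map hd ws1" by metis
    from map_eq_Cons_conv[THEN iffD1, OF 1(2)[symmetric]]
    obtain u ws2 where 2: "ws1 = u # ws2" "hd u = x" "map hd ws2 = bs @ x # cs" by metis
    from map_eq_append_conv[THEN iffD1, OF 2(3)]
    obtain Bs ws3 where 3: "ws2 = Bs @ ws3" "x # cs = map hd ws3" by metis
    from map_eq_Cons_conv[THEN iffD1, OF 3(2)[symmetric]]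
    obtain w Cs where 4: "ws3 = w # Cs" "hd w = x" by metis
    have split: "ws = As @ u # Bs @ w # Cs" and hd: "hd u = x" "hd w = x"
      using 1(1) 2(1,2) 3(1) 4 by simp_all
    have "u \<noteq> []" "w \<noteq> []" using ws unfolding split trail_decomposition_def by auto
    then obtain u' w' where u: "u = x # u'" and w: "w = x # w'"
      using hd by (metis list.collapse)
    let ?v = "rev u' @ x # w'"
    have "trail_edges ?v = rev (trail_edges u) @ trail_edges w"
      using trail_edges_append[of "rev u'" x w'] trail_edges_rev[of u] by (simp add: u w)
    then have "trail_decomposition E (?v # As @ Bs @ Cs)"
      using ws unfolding split trail_decomposition_def by (simp add: ac_simps)
    from least[OF this] show False unfolding split by simp
  qed
  with ws show ?thesis by blast
qed

text \<open>
  The vertex-sum at \<open>v\<close> contributed by a list of arcs that are labelled \<open>t, t - 1, t - 2, \<dots>\<close>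
  in this order.
\<close>

fun net_flow :: "'a \<Rightarrow> nat \<Rightarrow> ('a \<times> 'a) list \<Rightarrow> int" where
  "net_flow v t [] = 0"
| "net_flow v t ((x, y) # L) = of_bool (y = v) * int t - of_bool (x = v) * int t + net_flow v (t - 1) L"

lemma net_flow_append:
  "net_flow v t (L @ L') = net_flow v t L + net_flow v (t - length L) L'"
proof (induction L arbitrary: t)
  case (Cons a L)
  then show ?case by (cases a) simp
qed simp

text \<open>
  Each passage of a trail through \<open>v\<close> enters with a label that is one larger than the label with
  which it leaves. Thus only a start of the trail at \<open>v\<close> can contribute negatively.
\<close>

lemma net_flow_trail:
  assumes "w \<noteq> []"
  shows "- (of_bool (hd w = v) * int t) \<le> net_flow v t (trail_arcs w)"
  using assms
proof (induction w arbitrary: t rule: trail_arcs.induct)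
  case (1 x y w)
  have "- (of_bool (y = v) * int (t - 1)) \<le> net_flow v (t - 1) (trail_arcs (y # w))"
    using "1.IH"[of "t - 1"] by simp
  then show ?case by (cases "y = v") auto
qed simp_all

lemma net_flow_trails:
  assumes "[] \<notin> set ws" "distinct (map hd ws)"
  shows "- (of_bool (v \<in> hd ` set ws) * int t) \<le> net_flow v t (concat (map trail_arcs ws))"
  using assms
proof (induction ws arbitrary: t)
  case (Cons w ws)
  let ?t' = "t - length (trail_arcs w)"
  have "- (of_bool (hd w = v) * int t) \<le> net_flow v t (trail_arcs w)"
    using Cons.prems by (intro net_flow_trail) auto
  moreover have "- (of_bool (v \<in> hd ` set ws) * int ?t') \<le> net_flow v ?t' (concat (map trail_arcs ws))"
    using Cons by simp
  ultimately show ?case using Cons.prems(2)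
    by (cases "hd w = v"; cases "v \<in> hd ` set ws") (auto simp: net_flow_append)
qed simp

text \<open>
  This is the vertex-sum for a bare set of arcs; a single sum over the whole arc set makes it
  additive over disjoint unions.
\<close>

definition net_sum :: "('a \<times> 'a) set \<Rightarrow> ('a \<times> 'a \<Rightarrow> nat) \<Rightarrow> 'a \<Rightarrow> int" where
  "net_sum D \<tau> v = (\<Sum>x\<in>D. of_bool (snd x = v) * int (\<tau> x) - of_bool (fst x = v) * int (\<tau> x))"

lemma decreasing_labels:
  assumes "distinct L"
  shows "\<exists>\<sigma>. bij_betw \<sigma> (set L) {s + 1..s + length L} \<and>
    (\<forall>v. net_sum (set L) \<sigma> v = net_flow v (s + length L) L)"
  using assms
proof (induction L)
  case Nil
  then show ?case by (simp add: net_sum_def bij_betw_def)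
next
  case (Cons x L)
  then obtain \<sigma> where \<sigma>: "bij_betw \<sigma> (set L) {s + 1..s + length L}"
    "\<And>v. net_sum (set L) \<sigma> v = net_flow v (s + length L) L" and x: "x \<notin> set L" by auto
  let ?\<sigma> = "\<sigma>(x := s + Suc (length L))"
  have "bij_betw ?\<sigma> (set L) {s + 1..s + length L}"
    using \<sigma>(1) x by (subst bij_betw_cong[of _ _ \<sigma>]) auto
  then have "bij_betw ?\<sigma> (insert x (set L)) (insert (?\<sigma> x) {s + 1..s + length L})"
    using x by (subst (asm) notIn_Un_bij_betw3[of x _ ?\<sigma>]) auto
  moreover have "insert (?\<sigma> x) {s + 1..s + length L} = {s + 1..s + length (x # L)}" by auto
  moreover have "net_sum (set (x # L)) ?\<sigma> v = net_flow v (s + length (x # L)) (x # L)" for v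
  proof -
    have "net_sum (set L) ?\<sigma> v = net_sum (set L) \<sigma> v"
      unfolding net_sum_def using x by (intro sum.cong) auto
    then have "net_sum (set L) ?\<sigma> v = net_flow v (s + length L) L" using \<sigma>(2) by simp
    then show ?thesis using x unfolding net_sum_def by (cases x) simp
  qed
  ultimately show ?case by (metis list.simps(15))
qed

text \<open>
  With the edges oriented along trails that have distinct first vertices, and the labels used in
  decreasing order, each vertex pays for at most one start, hence at most the largest label.
\<close>

lemma orientation_with_small_deficits:
  assumes fin: "finite R" and sym: "\<And>u v. (u, v) \<in> R \<Longrightarrow> (v, u) \<in> R"
    and irrefl: "\<And>u v. (u, v) \<in> R \<Longrightarrow> u \<noteq> v"
  shows "\<exists>L \<sigma>. L \<subseteq> R \<and> (\<forall>(u, v)\<in>R. (u, v) \<in> L \<longleftrightarrow> (v, u) \<notin> L) \<and>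
    bij_betw \<sigma> L {s + 1..s + card L} \<and> (\<forall>v. - int (s + card L) \<le> net_sum L \<sigma> v)"
proof -
  define und where "und = (\<lambda>(x :: 'a, y). {x, y})"
  let ?E = "und ` R"
  obtain ws where ws: "trail_decomposition ?E ws" and heads: "distinct (map hd ws)"
    using trail_decomposition_distinct_heads[of ?E] fin unfolding und_def by fastforce
  define L where "L = concat (map trail_arcs ws)"
  have "mset (map und L) = mset_set ?E"
    using ws unfolding trail_decomposition_def trail_edges_def L_def und_def
    by (simp add: map_concat comp_def)
  then have "set_mset (mset (map und L)) = ?E" "size (mset (map und L)) = card ?E"
    using fin by simp_all
  then have set: "und ` set L = ?E" and dist: "distinct (map und L)"
    using card_distinct[of "map und L"] by simp_all
  have inj: "inj_on und (set L)" and "distinct L" using dist by (simp_all add: distinct_map)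
  have in_R: "set L \<subseteq> R"
  proof
    fix x assume "x \<in> set L"
    then have "und x \<in> und ` R" using set by blast
    then obtain y where "y \<in> R" "und x = und y" by blast
    then show "x \<in> R" using sym by (cases x; cases y) (auto simp: und_def doubleton_eq_iff)
  qed
  have "(u, v) \<in> set L \<longleftrightarrow> (v, u) \<notin> set L" if uv: "(u, v) \<in> R" for u v
  proof
    assume "(u, v) \<in> set L"
    moreover have "und (u, v) = und (v, u)" "(u, v) \<noteq> (v, u)"
      using irrefl[OF uv] by (auto simp: und_def)
    ultimately show "(v, u) \<notin> set L" using inj by (meson inj_onD)
  next
    assume "(v, u) \<notin> set L"
    have "und (u, v) \<in> und ` set L" using set uv by blast
    then obtain x y where xy: "(x, y) \<in> set L" "{x, y} = {u, v}"
      unfolding und_def by auto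
    then have "x = u \<and> y = v \<or> x = v \<and> y = u" by (simp add: doubleton_eq_iff)
    then show "(u, v) \<in> set L" using xy(1) \<open>(v, u) \<notin> set L\<close> by blast
  qed
  moreover obtain \<sigma> where \<sigma>: "bij_betw \<sigma> (set L) {s + 1..s + length L}"
    "\<And>v. net_sum (set L) \<sigma> v = net_flow v (s + length L) L"
    using decreasing_labels[OF \<open>distinct L\<close>] by blast
  moreover have "- int (s + length L) \<le> net_sum (set L) \<sigma> v" for v
  proof -
    have "- (of_bool (v \<in> hd ` set ws) * int (s + length L)) \<le> net_flow v (s + length L) L"
      using net_flow_trails[OF _ heads] ws unfolding L_def trail_decomposition_def by blast
    then show ?thesis using \<sigma>(2)[of v] by (cases "v \<in> hd ` set ws") auto
  qed
  ultimately show ?thesis using in_R distinct_card[OF \<open>distinct L\<close>]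
    by (intro exI[of _ "set L"] exI[of _ \<sigma>]) auto
qed

section \<open>Labels that increase with given weights\<close>

text \<open>Giving larger labels to heavier elements keeps the totals distinct.\<close>

lemma labels_following_weights:
  fixes w :: "'a \<Rightarrow> int"
  assumes "finite B"
  shows "\<exists>r. bij_betw r B {c + 1..c + card B} \<and> inj_on (\<lambda>b. w b + int (r b)) B"
proof -
  have "\<exists>r. bij_betw r B {c + 1..c + card B} \<and> (\<forall>a\<in>B. \<forall>b\<in>B. r a < r b \<longrightarrow> w a \<le> w b)"
    using assms
  proof (induction "card B" arbitrary: B)
    case 0
    then show ?case by (simp add: bij_betw_def)
  next
    case (Suc n)
    then have "B \<noteq> {}" by auto
    then have "Max (w ` B) \<in> w ` B" using \<open>finite B\<close> by simp
    then obtain m where "m \<in> B" "w m = Max (w ` B)" by force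
    then have m: "m \<in> B" "\<And>b. b \<in> B \<Longrightarrow> w b \<le> w m"
      using \<open>finite B\<close> by simp_all
    have card: "card (B - {m}) = n" "card B = Suc n" using Suc.hyps(2) m(1) \<open>finite B\<close> by simp_all
    then obtain r where r: "bij_betw r (B - {m}) {c + 1..c + n}"
      "\<forall>a\<in>B - {m}. \<forall>b\<in>B - {m}. r a < r b \<longrightarrow> w a \<le> w b"
      using Suc.hyps(1)[of "B - {m}"] \<open>finite B\<close> by auto
    let ?r = "r(m := c + Suc n)"
    have "bij_betw ?r (B - {m}) {c + 1..c + n}"
      using r(1) by (subst bij_betw_cong[of _ _ r]) auto
    then have "bij_betw ?r ((B - {m}) \<union> {m}) ({c + 1..c + n} \<union> {?r m})"
      by (subst (asm) notIn_Un_bij_betw3[of m _ ?r]) auto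
    moreover have "(B - {m}) \<union> {m} = B" "{c + 1..c + n} \<union> {?r m} = {c + 1..c + card B}"
      using m(1) card(2) by auto
    moreover have "w a \<le> w b" if ab: "a \<in> B" "b \<in> B" "?r a < ?r b" for a b
    proof (cases "b = m")
      case False
      have "r b \<le> c + n" using r(1) ab(2) False by (auto simp: bij_betw_def)
      then have "a \<noteq> m" using ab(3) False by auto
      then show ?thesis using r(2) ab False by auto
    qed (use m(2) ab in auto)
    ultimately show ?case by metis
  qed
  then obtain r where r: "bij_betw r B {c + 1..c + card B}"
    "\<forall>a\<in>B. \<forall>b\<in>B. r a < r b \<longrightarrow> w a \<le> w b" by blast
  have "inj_on (\<lambda>b. w b + int (r b)) B"
  proof (rule inj_onI)
    fix a b assume ab: "a \<in> B" "b \<in> B" "w a + int (r a) = w b + int (r b)"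
    then have "\<not> r a < r b" "\<not> r b < r a" using r(2) by force+
    then show "a = b" using r(1) ab by (auto simp: bij_betw_def dest: inj_onD)
  qed
  with r(1) show ?thesis by blast
qed

section \<open>Antimagic orientations from a saturating matching\<close>

lemma vertex_sum_eq_net_sum:
  assumes "finite (parcs D)"
  shows "vertex_sum D \<tau> v = net_sum (parcs D) \<tau> v"
proof -
  have filter: "(\<Sum>x\<in>{x \<in> parcs D. P x}. int (\<tau> x)) = (\<Sum>x\<in>parcs D. of_bool (P x) * int (\<tau> x))" for P
    unfolding sum.inter_filter[OF assms] by (intro sum.cong) auto
  then show ?thesis
    unfolding vertex_sum_def net_sum_def in_arcs_def out_arcs_def
    by (simp add: sum_subtractf)
qed

lemma edge_iff_arc:
  assumes "pair_graph G"
  shows "{u, v} \<in> edges_of G \<longleftrightarrow> (u, v) \<in> parcs G"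
proof -
  interpret pair_graph G by fact
  have "(y, x) \<in> parcs G" if "(x, y) \<in> parcs G" for x y
    using that pair_sym_arcs by (simp add: symmetric_def sym_def)
  then show ?thesis
    unfolding edges_of_def by (force simp: doubleton_eq_iff)
qed

lemma vertex_degree_eq_card_neighbours:
  assumes "pair_graph G"
  shows "vertex_degree G v = card {u. (v, u) \<in> parcs G}"
proof -
  interpret pair_graph G by fact
  have "{e \<in> edges_of G. v \<in> e} = (\<lambda>u. {v, u}) ` {u. (v, u) \<in> parcs G}" (is "?l = ?r")
  proof
    show "?l \<subseteq> ?r"
    proof
      fix e assume e: "e \<in> ?l"
      then obtain x y where "e = {x, y}" unfolding edges_of_def by auto
      with e obtain u where "e = {v, u}" by auto
      with e show "e \<in> ?r" using edge_iff_arc[OF assms] by auto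
    qed
    show "?r \<subseteq> ?l" using edge_iff_arc[OF assms] by auto
  qed
  moreover have "inj_on (\<lambda>u. {v, u}) {u. (v, u) \<in> parcs G}"
    by (auto simp: inj_on_def doubleton_eq_iff)
  ultimately show ?thesis unfolding vertex_degree_def by (simp add: card_image)
qed

text \<open>
  Since \<open>A\<close> is independent, each edge of \<open>M\<close> has an end outside \<open>A\<close>, and by the size of \<open>M\<close>
  it has exactly one. So \<open>M\<close> sends every vertex outside \<open>A\<close> to a partner in \<open>A\<close>.
\<close>

lemma saturating_matching_injection:
  assumes G: "pair_graph G" and indep: "independent_set G A"
    and M: "matching G M" and card_M: "card M = card (pverts G) - card A"
    and sat: "\<And>v. v \<in> pverts G - A \<Longrightarrow> saturates M v"
  shows "\<exists>\<mu>. inj_on \<mu> (pverts G - A) \<and>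
    (\<forall>b\<in>pverts G - A. \<mu> b \<in> A \<and> (\<mu> b, b) \<in> parcs G)"
proof -
  interpret pair_graph G by fact
  let ?B = "pverts G - A"
  have A: "A \<subseteq> pverts G" using indep unfolding independent_set_def by blast
  have finB: "finite ?B" using pair_finite_verts by blast
  have card_B: "card ?B = card M"
    using card_M A pair_finite_verts finite_subset[OF A] by (simp add: card_Diff_subset)
  have disj: "e = f" if "e \<in> M" "f \<in> M" "x \<in> e" "x \<in> f" for e f x
    using M that unfolding matching_def by blast
  obtain \<phi> where \<phi>: "\<And>b. b \<in> ?B \<Longrightarrow> \<phi> b \<in> M \<and> b \<in> \<phi> b"
    using sat unfolding saturates_def by metis
  have edge: "\<exists>u v. e = {u, v} \<and> (u, v) \<in> parcs G" if "e \<in> M" for e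
    using M that unfolding matching_def edges_of_def by force
  have "\<phi> ` ?B = M"
  proof
    show "\<phi> ` ?B \<subseteq> M" using \<phi> by blast
    show "M \<subseteq> \<phi> ` ?B"
    proof
      fix e assume e: "e \<in> M"
      obtain u v where uv: "e = {u, v}" "(u, v) \<in> parcs G" using edge[OF e] by blast
      then have "\<not> (u \<in> A \<and> v \<in> A)"
        using indep edge_iff_arc[OF G] unfolding independent_set_def by blast
      then obtain b where b: "b \<in> e" "b \<in> ?B"
        using uv in_arcsD1 in_arcsD2 by blast
      then have "\<phi> b = e" using disj \<phi> e by blast
      then show "e \<in> \<phi> ` ?B" using b by blast
    qed
  qed
  then have inj: "inj_on \<phi> ?B" using finB card_B by (simp add: eq_card_imp_inj_on)
  have "\<exists>a. a \<in> A \<and> \<phi> b = {a, b}" if b: "b \<in> ?B" for b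
  proof -
    obtain u v where uv: "\<phi> b = {u, v}" "(u, v) \<in> parcs G" using edge \<phi> b by blast
    then have uv_in: "u \<in> pverts G" "v \<in> pverts G" "u \<noteq> v"
      using in_arcsD1 in_arcsD2 no_loops' by blast+
    then obtain a where a: "\<phi> b = {a, b}" "a \<noteq> b" "a \<in> pverts G"
      using uv \<phi>[OF b] by auto
    have "a \<in> A"
    proof (rule ccontr)
      assume "a \<notin> A"
      then have "\<phi> a = \<phi> b" using disj[of "\<phi> a" "\<phi> b" a] \<phi> a b by blast
      then show False using inj \<open>a \<notin> A\<close> a b by (auto dest: inj_onD)
    qed
    with a show ?thesis by blast
  qed
  then obtain \<mu> where \<mu>: "\<And>b. b \<in> ?B \<Longrightarrow> \<mu> b \<in> A \<and> \<phi> b = {\<mu> b, b}" by metis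
  have "inj_on \<mu> ?B"
  proof (rule inj_onI)
    fix b c assume bc: "b \<in> ?B" "c \<in> ?B" "\<mu> b = \<mu> c"
    have "\<mu> b \<in> \<phi> b" "\<mu> b \<in> \<phi> c" using \<mu>[OF bc(1)] \<mu>[OF bc(2)] bc(3) by simp_all
    then have "\<phi> b = \<phi> c" using disj \<phi> bc(1,2) by blast
    then show "b = c" using inj bc by (auto dest: inj_onD)
  qed
  moreover have "(\<mu> b, b) \<in> parcs G" if "b \<in> ?B" for b
  proof -
    have "{\<mu> b, b} \<in> edges_of G" using \<mu> \<phi> that M unfolding matching_def by (metis subsetD)
    then show ?thesis using edge_iff_arc[OF G] by simp
  qed
  ultimately show ?thesis using \<mu> by blast
qed

text \<open>
  Every \<open>a \<in> A\<close> selects a primary arc \<open>(a, pr a)\<close>, which is its matching edge if it has one. The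
  labels \<open>1, \<dots>, S\<close> go to the secondary edges at \<open>A\<close>, the next ones up to \<open>c\<close> to the edges
  inside \<open>B\<close>, and the \<open>q\<close> largest to the primary edges.
\<close>

lemma antimagic_orientation_of_matched_complement:
  assumes G: "pair_graph G" and AV: "A \<subseteq> pverts G"
    and indep: "\<And>u v. u \<in> A \<Longrightarrow> v \<in> A \<Longrightarrow> (u, v) \<notin> parcs G"
    and \<mu>_inj: "inj_on \<mu> (pverts G - A)"
    and \<mu>: "\<And>b. b \<in> pverts G - A \<Longrightarrow> \<mu> b \<in> A" "\<And>b. b \<in> pverts G - A \<Longrightarrow> (\<mu> b, b) \<in> parcs G"
    and deg: "\<And>a. a \<in> A \<Longrightarrow> 3 \<le> card {b. (a, b) \<in> parcs G}"
  shows "\<exists>D \<tau>. antimagic_orientation G (D, \<tau>)"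
proof -
  interpret pair_graph G by fact
  define R B where "R = parcs G" and "B = pverts G - A"
  define Nb where "Nb a = {b. (a, b) \<in> R}" for a
  have sym: "(v, u) \<in> R" if "(u, v) \<in> R" for u v
    using that pair_sym_arcs unfolding R_def by (simp add: symmetric_def sym_def)
  have finR: "finite R" and finA: "finite A" and finB: "finite B"
    using pair_finite_arcs pair_finite_verts finite_subset[OF AV] unfolding R_def B_def by auto
  have finNb: "finite (Nb a)" for a
  proof (rule finite_subset)
    show "Nb a \<subseteq> snd ` R" unfolding Nb_def by force
  qed (use finR in simp)
  have NbB: "Nb a \<subseteq> B" if "a \<in> A" for a
    using that indep in_arcsD2 unfolding Nb_def R_def B_def by blast

  define pr where "pr a = (if a \<in> \<mu> ` B then inv_into B \<mu> a else SOME b. b \<in> Nb a)" for a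
  have pr_\<mu>: "pr (\<mu> b) = b" if "b \<in> B" for b
    using that \<mu>_inj unfolding pr_def B_def by simp
  have pr: "pr a \<in> Nb a" if "a \<in> A" for a
  proof (cases "a \<in> \<mu> ` B")
    case True
    then show ?thesis using pr_\<mu> \<mu>(2) unfolding Nb_def R_def B_def by auto
  next
    case False
    have "Nb a \<noteq> {}" using deg[OF that] unfolding Nb_def R_def by (metis card.empty not_numeral_le_zero)
    then show ?thesis using False unfolding pr_def by (simp add: some_in_eq)
  qed

  define d where "d a = card (Nb a - {pr a})" for a
  define S where "S = sum d A"
  define q where "q = card A"
  have "2 \<le> d a" if "a \<in> A" for a
    using deg[OF that] pr[OF that] finNb[of a] unfolding d_def Nb_def R_def by simp
  then obtain X N where N: "2 * q \<le> N" and X_disj: "disjoint_family_on X A"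
    and X: "\<And>a. a \<in> A \<Longrightarrow> X a \<subseteq> {1..S}" "\<And>a. a \<in> A \<Longrightarrow> card (X a) = d a"
      "\<And>a. a \<in> A \<Longrightarrow> N dvd 2 * \<Sum>(X a)"
    using zero_sum_blocks[OF finA, of d] unfolding S_def q_def by blast
  have "\<exists>h. bij_betw h (Nb a - {pr a}) (X a)" if "a \<in> A" for a
    using finite_same_card_bij[of "Nb a - {pr a}" "X a"] X(1,2)[OF that] finNb[of a]
      finite_subset[of "X a" "{1..S}"] unfolding d_def by simp
  then obtain F where F: "\<And>a. a \<in> A \<Longrightarrow> bij_betw (F a) (Nb a - {pr a}) (X a)" by metis

  define RB where "RB = {(u, v) \<in> R. u \<notin> A \<and> v \<notin> A}"
  have "finite RB" using finR unfolding RB_def by (rule rev_finite_subset) auto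
  then have "\<exists>L \<sigma>. L \<subseteq> RB \<and> (\<forall>(u, v)\<in>RB. (u, v) \<in> L \<longleftrightarrow> (v, u) \<notin> L) \<and>
      bij_betw \<sigma> L {S + 1..S + card L} \<and> (\<forall>v. - int (S + card L) \<le> net_sum L \<sigma> v)"
    using sym no_loops' unfolding RB_def R_def by (intro orientation_with_small_deficits) auto
  then obtain L \<sigma> where L: "L \<subseteq> RB"
    and L_orients: "\<forall>(u, v)\<in>RB. (u, v) \<in> L \<longleftrightarrow> (v, u) \<notin> L"
    and \<sigma>: "bij_betw \<sigma> L {S + 1..S + card L}"
    and L_low: "\<And>v. - int (S + card L) \<le> net_sum L \<sigma> v"
    by (elim exE conjE) blast
  have L_or: "(u, v) \<in> L \<longleftrightarrow> (v, u) \<notin> L" if "(u, v) \<in> R" "u \<notin> A" "v \<notin> A" for u v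
    using bspec[OF L_orients, of "(u, v)"] that unfolding RB_def by simp
  have finL: "finite L" using L \<open>finite RB\<close> by (rule finite_subset)
  define c where "c = S + card L"

  \<comment> \<open>Unmatched vertices of \<open>A\<close> receive the lowest primary labels, in any order. This must precede
    the choice of the matching labels \<open>r\<close>, since \<open>w b\<close>, the vertex-sum at \<open>b\<close> apart from its
    matching edge, may involve them.\<close>
  define free where "free = A - \<mu> ` B"
  have \<mu>B: "\<mu> ` B \<subseteq> A" using \<mu>(1) unfolding B_def by blast
  have card_free: "card free + card B = q"
  proof -
    have "card (\<mu> ` B) = card B" using \<mu>_inj unfolding B_def by (rule card_image)
    then show ?thesis unfolding free_def q_def
      using \<mu>B finA card_mono[OF finA \<mu>B] finite_subset[OF \<mu>B finA] by (simp add: card_Diff_subset)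
  qed
  obtain g where g: "bij_betw g free {c + 1..c + card free}"
    using finite_same_card_bij[of free "{c + 1..c + card free}"] finA unfolding free_def by auto
  define w where "w b = (\<Sum>a\<in>{a \<in> A. b \<in> Nb a} - {\<mu> b}. int (if b = pr a then g a else F a b))
      + net_sum L \<sigma> b" for b
  obtain r where r: "bij_betw r B {c + card free + 1..c + card free + card B}"
    and r_inj: "inj_on (\<lambda>b. w b + int (r b)) B"
    using labels_following_weights[OF finB, of "c + card free" w] by blast
  define l where "l a = (if a \<in> free then g a else r (pr a))" for a
  have l: "bij_betw l A {c + 1..c + q}"
  proof -
    have "bij_betw pr (\<mu> ` B) B"
      using pr_\<mu> by (intro bij_betw_byWitness[of _ \<mu>]) auto
    then have "bij_betw (r \<circ> pr) (\<mu> ` B) {c + card free + 1..c + card free + card B}"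
      using r by (rule bij_betw_trans)
    then have "bij_betw l (\<mu> ` B) {c + card free + 1..c + card free + card B}"
      by (subst bij_betw_cong[of _ _ "r \<circ> pr"]) (auto simp: l_def free_def)
    moreover have "bij_betw l free {c + 1..c + card free}"
      using g by (subst bij_betw_cong[of _ _ g]) (auto simp: l_def)
    ultimately have "bij_betw l (free \<union> \<mu> ` B)
        ({c + 1..c + card free} \<union> {c + card free + 1..c + card free + card B})"
      by (intro bij_betw_combine) auto
    moreover have "free \<union> \<mu> ` B = A" using \<mu>B unfolding free_def by blast
    moreover have "{c + 1..c + card free} \<union> {c + card free + 1..c + card free + card B} = {c + 1..c + q}"
      unfolding card_free[symmetric] by auto
    ultimately show ?thesis by simp
  qed

  define \<tau> where "\<tau> x = (if fst x \<in> A then if snd x = pr (fst x) then l (fst x) else F (fst x) (snd x)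
      else \<sigma> x)" for x
  define DA where "DA = Sigma A Nb"
  define D where "D = \<lparr>pverts = pverts G, parcs = DA \<union> L\<rparr>"
  have finDA: "finite DA" unfolding DA_def using finA finNb by blast
  have L_notA: "fst x \<notin> A" "snd x \<notin> A" if "x \<in> L" for x
    using L that unfolding RB_def by auto
  have disj_DA_L: "DA \<inter> L = {}" using L_notA unfolding DA_def by fastforce

  have orient: "orientation_of D G"
  proof -
    have "DA \<subseteq> R" unfolding DA_def Nb_def by blast
    moreover have "(u, v) \<in> DA \<union> L \<longleftrightarrow> (v, u) \<notin> DA \<union> L" if uv: "(u, v) \<in> R" for u v
    proof (cases "u \<in> A \<or> v \<in> A")
      case True
      moreover have "\<not> (u \<in> A \<and> v \<in> A)" using indep uv unfolding R_def by blast
      ultimately show ?thesis using uv sym[OF uv] L_notA unfolding DA_def Nb_def by fastforce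
    next
      case False
      then show ?thesis using L_or[OF uv] unfolding DA_def by blast
    qed
    ultimately show ?thesis using L unfolding RB_def orientation_of_def D_def R_def by auto
  qed
  have bij: "bij_betw \<tau> (parcs D) {1..card (parcs D)}"
  proof -
    define DS where "DS = Sigma A (\<lambda>a. Nb a - {pr a})"
    define DP where "DP = (\<lambda>a. (a, pr a)) ` A"
    have "bij_betw \<tau> DS {1..S}"
    proof -
      have val: "\<tau> (a, b) = F a b" "F a b \<in> X a" if "(a, b) \<in> DS" for a b
        using that F unfolding \<tau>_def DS_def by (auto simp: bij_betw_def)
      have "inj_on \<tau> DS"
      proof (rule inj_onI, clarify)
        fix a b a' b' assume ab: "(a, b) \<in> DS" "(a', b') \<in> DS" "\<tau> (a, b) = \<tau> (a', b')"
        then have "F a b \<in> X a \<inter> X a'" using val by (metis IntI)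
        moreover have A: "a \<in> A" "a' \<in> A" using ab unfolding DS_def by auto
        ultimately have "a = a'" using X_disj unfolding disjoint_family_on_def by blast
        then show "a = a' \<and> b = b'"
          using ab val F[OF A(1)] unfolding DS_def bij_betw_def by (auto dest: inj_onD)
      qed
      moreover have "\<tau> ` DS = {1..S}"
      proof (rule card_subset_eq)
        show "\<tau> ` DS \<subseteq> {1..S}"
        proof (clarify)
          fix a b assume ab: "(a, b) \<in> DS"
          then have "a \<in> A" unfolding DS_def by blast
          then show "\<tau> (a, b) \<in> {1..S}" using val[OF ab] X(1)[of a] by (metis subsetD)
        qed
        have "card DS = S" unfolding DS_def S_def d_def using finA finNb by simp
        then show "card (\<tau> ` DS) = card {1..S}"
          using card_image[OF \<open>inj_on \<tau> DS\<close>] by simp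
      qed simp
      ultimately show ?thesis unfolding bij_betw_def ..
    qed
    moreover have "bij_betw \<tau> L {S + 1..c}"
      using \<sigma> L_notA unfolding c_def by (subst bij_betw_cong[of _ _ \<sigma>]) (auto simp: \<tau>_def)
    moreover have "bij_betw \<tau> DP {c + 1..c + q}"
    proof -
      have "bij_betw (\<tau> \<circ> (\<lambda>a. (a, pr a))) A {c + 1..c + q}"
        using l by (subst bij_betw_cong[of _ _ l]) (auto simp: \<tau>_def)
      moreover have "bij_betw (\<lambda>a. (a, pr a)) A DP"
        unfolding DP_def by (auto simp: bij_betw_def inj_on_def)
      ultimately show ?thesis using bij_betw_comp_iff by blast
    qed
    ultimately have "bij_betw \<tau> (DS \<union> L \<union> DP) ({1..S} \<union> {S + 1..c} \<union> {c + 1..c + q})"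
      by (intro bij_betw_combine) (auto simp: c_def)
    moreover have "DS \<union> L \<union> DP = parcs D"
      unfolding DS_def DP_def D_def DA_def using pr by auto
    moreover have "{1..S} \<union> {S + 1..c} \<union> {c + 1..c + q} = {1..c + q}"
      unfolding c_def by auto
    ultimately have "bij_betw \<tau> (parcs D) {1..c + q}" by simp
    then show ?thesis using bij_betw_same_card by fastforce
  qed
  have sum_A: "vertex_sum D \<tau> a = - int (\<Sum>(X a) + l a)" if a: "a \<in> A" for a
  proof -
    have "in_arcs (with_proj D) a = {}"
      unfolding in_arcs_def D_def DA_def using a NbB L_notA unfolding B_def by fastforce
    moreover have "out_arcs (with_proj D) a = Pair a ` Nb a"
      unfolding out_arcs_def D_def DA_def using a L_notA by auto
    moreover have "(\<Sum>x\<in>Pair a ` Nb a. \<tau> x) = (\<Sum>b\<in>Nb a. \<tau> (a, b))"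
      by (simp add: sum.reindex inj_on_def)
    moreover have "\<dots> = \<tau> (a, pr a) + (\<Sum>b\<in>Nb a - {pr a}. \<tau> (a, b))"
      using finNb pr[OF a] by (rule sum.remove)
    moreover have "(\<Sum>b\<in>Nb a - {pr a}. \<tau> (a, b)) = (\<Sum>b\<in>Nb a - {pr a}. F a b)"
      using a by (intro sum.cong) (auto simp: \<tau>_def)
    moreover have "\<dots> = \<Sum>(X a)"
      using sum.reindex_bij_betw[OF F[OF a], of "\<lambda>x. x"] .
    ultimately show ?thesis using a unfolding vertex_sum_def
      by (simp add: \<tau>_def flip: of_nat_sum)
  qed
  have sum_B: "vertex_sum D \<tau> b = w b + int (r b)" if b: "b \<in> B" for b
  proof -
    let ?I = "{a \<in> A. b \<in> Nb a}"
    have bA: "b \<notin> A" using b unfolding B_def by blast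
    have "vertex_sum D \<tau> b = net_sum DA \<tau> b + net_sum L \<tau> b"
      using vertex_sum_eq_net_sum[of D] finDA finL disj_DA_L
      unfolding D_def net_sum_def by (simp add: sum.union_disjoint)
    moreover have "net_sum L \<tau> b = net_sum L \<sigma> b"
      unfolding net_sum_def using L_notA by (intro sum.cong) (auto simp: \<tau>_def)
    moreover have "net_sum DA \<tau> b = (\<Sum>a\<in>?I. int (\<tau> (a, b)))"
    proof -
      have "net_sum DA \<tau> b = (\<Sum>x\<in>DA. if snd x = b then int (\<tau> x) else 0)"
        unfolding net_sum_def DA_def using bA by (intro sum.cong) auto
      also have "\<dots> = (\<Sum>x\<in>{x \<in> DA. snd x = b}. int (\<tau> x))"
        using finDA by (simp add: sum.inter_filter)
      also have "{x \<in> DA. snd x = b} = (\<lambda>a. (a, b)) ` ?I" unfolding DA_def by auto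
      also have "(\<Sum>x\<in>(\<lambda>a. (a, b)) ` ?I. int (\<tau> x)) = (\<Sum>a\<in>?I. int (\<tau> (a, b)))"
        by (simp add: sum.reindex inj_on_def)
      finally show ?thesis .
    qed
    moreover have "\<dots> = int (\<tau> (\<mu> b, b)) + (\<Sum>a\<in>?I - {\<mu> b}. int (\<tau> (a, b)))"
      using finA \<mu> b by (intro sum.remove) (auto simp: Nb_def R_def B_def)
    moreover have "(\<Sum>a\<in>?I - {\<mu> b}. int (\<tau> (a, b)))
        = (\<Sum>a\<in>?I - {\<mu> b}. int (if b = pr a then g a else F a b))"
    proof (intro sum.cong refl)
      \<comment> \<open>An arc \<open>(a, b)\<close> that is primary but not the matching edge of \<open>b\<close> has an unmatched \<open>a\<close>.\<close>
      fix a assume a: "a \<in> ?I - {\<mu> b}"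
      then have "a \<in> free" if "b = pr a" using that pr_\<mu> unfolding free_def by auto
      then show "int (\<tau> (a, b)) = int (if b = pr a then g a else F a b)"
        using a by (simp add: \<tau>_def l_def)
    qed
    moreover have "\<tau> (\<mu> b, b) = r b"
      using b pr_\<mu>[OF b] \<mu>B by (auto simp: \<tau>_def l_def free_def)
    ultimately show ?thesis unfolding w_def by simp
  qed
  have distinct: "vertex_sum D \<tau> u \<noteq> vertex_sum D \<tau> v"
    if uv: "u \<in> pverts D" "v \<in> pverts D" "u \<noteq> v" for u v
  proof -
    have l_range: "l a \<in> {c + 1..c + q}" if "a \<in> A" for a using l that by (auto simp: bij_betw_def)
    have neg: "vertex_sum D \<tau> a < 0" if "a \<in> A" for a
    proof -
      have "0 < \<Sum>(X a) + l a" using l_range[OF that] by simp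
      then show ?thesis using sum_A[OF that] by linarith
    qed
    have pos: "0 < vertex_sum D \<tau> b" if "b \<in> B" for b
    proof -
      have "r b \<in> {c + card free + 1..c + card free + card B}" using r that by (auto simp: bij_betw_def)
      then have "c < r b" by simp
      moreover have "0 \<le> (\<Sum>a\<in>{a \<in> A. b \<in> Nb a} - {\<mu> b}. int (if b = pr a then g a else F a b))"
        by (rule sum_nonneg) simp
      ultimately show ?thesis using sum_B[OF that] L_low[of b] unfolding w_def c_def by linarith
    qed
    consider "u \<in> A" "v \<in> A" | "u \<in> A" "v \<in> B" | "u \<in> B" "v \<in> A" | "u \<in> B" "v \<in> B"
      using uv unfolding D_def B_def by auto
    then show ?thesis
    proof cases
      case 1
      show ?thesis
      proof
        assume "vertex_sum D \<tau> u = vertex_sum D \<tau> v"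
        then have "\<Sum>(X u) + l u = \<Sum>(X v) + l v"
          using sum_A[OF 1(1)] sum_A[OF 1(2)] by linarith
        then have "l u = l v"
          using eq_of_small_shift X(3) N l_range 1 by metis
        then show False using l 1 uv(3) by (auto simp: bij_betw_def dest: inj_onD)
      qed
    next
      case 4
      then show ?thesis using r_inj uv(3) sum_B by (auto dest: inj_onD)
    qed (use neg pos in fastforce)+
  qed
  show ?thesis
  proof (intro exI)
    show "antimagic_orientation G (D, \<tau>)"
      using orient bij distinct unfolding antimagic_orientation_def antimagic_labeling_def by simp
  qed
qed

theorem theorem1p5:
  fixes G :: "'a pair_pre_digraph" and A :: "'a set"
  assumes "pair_graph G"
    and "independent_set G A"
    and "\<exists>M. matching G M \<and> card M = card (pverts G) - card A
             \<and> (\<forall>v \<in> pverts G - A. saturates M v)"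
    and "\<forall>v\<in>A. vertex_degree G v \<ge> 3"
  shows "\<exists>D \<tau>. antimagic_orientation G (D, \<tau>)"
proof -
  from assms(3) obtain M where "matching G M" "card M = card (pverts G) - card A"
    "\<And>v. v \<in> pverts G - A \<Longrightarrow> saturates M v" by blast
  then obtain \<mu> where "inj_on \<mu> (pverts G - A)"
    "\<And>b. b \<in> pverts G - A \<Longrightarrow> \<mu> b \<in> A" "\<And>b. b \<in> pverts G - A \<Longrightarrow> (\<mu> b, b) \<in> parcs G"
    using saturating_matching_injection[OF assms(1,2)] by blast
  moreover have "A \<subseteq> pverts G" "\<And>u v. u \<in> A \<Longrightarrow> v \<in> A \<Longrightarrow> (u, v) \<notin> parcs G"
    using assms(2) edge_iff_arc[OF assms(1)] unfolding independent_set_def by blast+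
  moreover have "\<And>a. a \<in> A \<Longrightarrow> 3 \<le> card {b. (a, b) \<in> parcs G}"
    using assms(4) vertex_degree_eq_card_neighbours[OF assms(1)] by simp
  ultimately show ?thesis
    using antimagic_orientation_of_matched_complement[OF assms(1)] by blast
qed

end
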